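(* The selective greedy method does not cycle. That is, let $\mathcal{F}$ be a product family with non-empty compact uncertainty sets $\mathcal{F}_1,\ldots,\mathcal{F}_d\subset\mathbb{R}^d_+$, and let $A_1,A_2,\ldots$ be a sequence of matrices produced by the selective greedy method (for maximization, or for minimization, of the spectral radius) from an arbitrary initial matrix $A_1\in\mathcal{F}$. If $A_{k+n}=A_k$ for some $k\ge1$, $n\ge 1$, then $A_{k+1}=A_k$.
   Context: Product family: for non-empty compact sets (uncertainty sets) $\mathcal{F}_i\subset\mathbb{R}^d_+$, $i=1,\ldots,d$, $\mathcal{F}$ is the set of all $d\times d$ matrices whose $i$th row belongs to $\mathcal{F}_i$ for each $i$. A leading eigenvector of a non-negative matrix $A$ is a non-zero non-negative eigenvector for the eigenvalue $\rho(A)$ (the spectral radius). The selected leading eigenvector of $A$ is $\lim_{\varepsilon\to0+}\boldsymbol{v}_\varepsilon$, where $\boldsymbol{v}_\varepsilon$ is the unique non-negative leading eigenvector of Euclidean norm $1$ of $A+\varepsilon E$ and $E$ is the all-ones matrix. Greedy method (maximization): given $A_k\in\mathcal{F}$ with rows $\boldsymbol{a}^{(k)}_i$, take a leading eigenvector $\boldsymbol{v}_k$ of $A_k$. For each $i=1,\ldots,d$: if $(\boldsymbol{a}^{(k)}_i,\boldsymbol{v}_k)=\max_{\boldsymbol{a}\in\mathcal{F}_i}(\boldsymbol{a},\boldsymbol{v}_k)$, set $\boldsymbol{a}^{(k+1)}_i=\boldsymbol{a}^{(k)}_i$; otherwise let $\boldsymbol{a}^{(k+1)}_i\in\mathcal{F}_i$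 be any maximizer of $(\boldsymbol{a},\boldsymbol{v}_k)$ over $\boldsymbol{a}\in\mathcal{F}_i$. The matrix $A_{k+1}$ has rows $\boldsymbol{a}_i^{(k+1)}$. The iterations stop when $A_{k+1}=A_k$. The greedy method for minimization is the same with $\max$ replaced by $\min$. The selective greedy method is the greedy method in which, in every iteration, $\boldsymbol{v}_k$ is the selected leading eigenvector of $A_k$. *)

theory Defs
  imports "HOL-Analysis.Analysis"
begin

definition product_family :: "('n::finite \<Rightarrow> (real^'n) set) \<Rightarrow> (real^'n^'n) set" where
  "product_family F = {A. \<forall>i. row i A \<in> F i}"

(* As usual for the spectral radius, the eigenvalues of a real matrix are taken over the
   complex numbers; there are finitely many and at least one of them, so Max is meaningful. *)
definition complex_eigenvalues :: "real^'n^'n \<Rightarrow> complex set" where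
  "complex_eigenvalues A =
     {l. \<exists>w::complex^'n. w \<noteq> 0 \<and> map_matrix complex_of_real A *v w = l *s w}"

definition spectral_radius :: "real^'n^'n \<Rightarrow> real" where
  "spectral_radius A = Max (cmod ` complex_eigenvalues A)"

definition leading_eigenvector :: "real^'n^'n \<Rightarrow> real^'n \<Rightarrow> bool" where
  "leading_eigenvector A v \<longleftrightarrow>
     v \<noteq> 0 \<and> (\<forall>i. 0 \<le> v $ i) \<and> A *v v = spectral_radius A *\<^sub>R v"

definition ones_matrix :: "real^'n^'n" where
  "ones_matrix = (\<chi> i j. 1)"

(* The description is proper when A is non-negative and e > 0: then A + e E is entrywise
   positive and its normalized leading eigenvector is unique (Perron). *)
definition perturbed_leading_eigenvector :: "real^'n^'n \<Rightarrow> real \<Rightarrow> real^'n" where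
  "perturbed_leading_eigenvector A e =
     (THE v. leading_eigenvector (A + e *\<^sub>R ones_matrix) v \<and> norm v = 1)"

definition selected_leading_eigenvector :: "real^'n^'n \<Rightarrow> real^'n \<Rightarrow> bool" where
  "selected_leading_eigenvector A v \<longleftrightarrow>
     (perturbed_leading_eigenvector A \<longlongrightarrow> v) (at_right 0)"

(* The parameter opt is is_arg_max (maximization) or is_arg_min (minimization); for instance
   is_arg_max f P a says that a satisfies P and maximizes f among all points satisfying P. *)
definition greedy_step ::
  "((real^'n \<Rightarrow> real) \<Rightarrow> (real^'n \<Rightarrow> bool) \<Rightarrow> real^'n \<Rightarrow> bool) \<Rightarrow>
   ('n \<Rightarrow> (real^'n) set) \<Rightarrow> real^'n \<Rightarrow> real^'n^'n \<Rightarrow> real^'n^'n \<Rightarrow> bool" where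
  "greedy_step opt F v A A' \<longleftrightarrow>
     (\<forall>i. if opt (\<lambda>a. a \<bullet> v) (\<lambda>a. a \<in> F i) (row i A)
          then row i A' = row i A
          else opt (\<lambda>a. a \<bullet> v) (\<lambda>a. a \<in> F i) (row i A'))"

(* Sequences are indexed from 1; the values at 0 are irrelevant. A run that stops is
   continued by repeating its last matrix and vector: when A (k + 1) = A k, every row of A k
   is already optimal for v k, so greedy_step allows no further change with this v k. *)
definition greedy_run ::
  "((real^'n \<Rightarrow> real) \<Rightarrow> (real^'n \<Rightarrow> bool) \<Rightarrow> real^'n \<Rightarrow> bool) \<Rightarrow>
   ('n::finite \<Rightarrow> (real^'n) set) \<Rightarrow> (nat \<Rightarrow> real^'n^'n) \<Rightarrow> (nat \<Rightarrow> real^'n) \<Rightarrow> bool" where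
  "greedy_run opt F A v \<longleftrightarrow>
     A 1 \<in> product_family F \<and>
     (\<forall>k\<ge>1. leading_eigenvector (A k) (v k) \<and> greedy_step opt F (v k) (A k) (A (Suc k)))"

definition selective_greedy_run ::
  "((real^'n \<Rightarrow> real) \<Rightarrow> (real^'n \<Rightarrow> bool) \<Rightarrow> real^'n \<Rightarrow> bool) \<Rightarrow>
   ('n::finite \<Rightarrow> (real^'n) set) \<Rightarrow> (nat \<Rightarrow> real^'n^'n) \<Rightarrow> (nat \<Rightarrow> real^'n) \<Rightarrow> bool" where
  "selective_greedy_run opt F A v \<longleftrightarrow>
     greedy_run opt F A v \<and> (\<forall>k\<ge>1. selected_leading_eigenvector (A k) (v k))"

end

theory Submission
  imports Defs "HOL-Computational_Algebra.Polynomial"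
begin

text \<open>
  The selected eigenvector of a matrix \<open>A\<close> is a limit of Perron eigenvectors of the positive
  matrices \<open>A + e E\<close>, with \<open>E\<close> the all-ones matrix, and this makes a greedy step strictly
  improving for the perturbed matrices even when \<open>\<rho>(A)\<close> itself stays the same.

  Consider maximization and a step from \<open>A\<close> to \<open>A' \<noteq> A\<close>, with selected eigenvector \<open>v\<close>. A row is
  replaced only if this strictly increases its inner product with \<open>v\<close>. Strict inequalities survive
  a small change of \<open>v\<close>, so for all small \<open>e > 0\<close> they also hold with the Perron eigenvector
  \<open>v\<^sub>e\<close> of \<open>A + e E\<close> in place of \<open>v\<close>. The other rows being unchanged,
  \<open>(A' + e E) v\<^sub>e \<ge> (A + e E) v\<^sub>e = \<rho>(A + e E) v\<^sub>e\<close>, with strict inequality in some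
  component. Multiplying on the left by a positive left Perron eigenvector of \<open>A' + e E\<close>
  gives \<open>\<rho>(A' + e E) > \<rho>(A + e E)\<close>
  (\<open>spectral_radius_compare_on_leading_eigenvector\<close>,
  \<open>eventually_perturbed_spectral_radius_mono\<close>).

  A cycle has finitely many steps, so a single \<open>e\<close> works for all of them. For that \<open>e\<close>
  the perturbed spectral radius never decreases along the cycle and increases at every step that
  changes the matrix. As it returns to its initial value, no step changes the matrix
  (\<open>selective_greedy_run_no_cycle\<close>). Minimization is the same argument with reversed
  inequalities; a sign \<open>s\<close>, equal to \<open>1\<close> or \<open>-1\<close>, treats both at once.

  What is needed from Perron's theorem is that a positive matrix has positive right and left
  eigenvectors for its spectral radius, and that its normalized leading eigenvector is unique, which
  makes the perturbed eigenvectors well defined.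
\<close>

section \<open>Eigenvalues and the spectral radius\<close>

text \<open>
  Compare the moduli of an eigenvector \<open>w\<close> with the weights \<open>u\<close> in an index where
  \<open>\<bar>w\<^sub>i\<bar> / u\<^sub>i\<close> is largest. Unit weights bound all eigenvalues of a matrix by its
  entries; a positive eigenvector as weight shows that its eigenvalue dominates all others.
\<close>

lemma complex_eigenvalue_le_weighted_row_sums:
  fixes A :: "real^'n^'n"
  assumes u: "\<And>i. 0 < u $ i" and Au: "\<And>i. (\<Sum>j\<in>UNIV. \<bar>A $ i $ j\<bar> * u $ j) \<le> r * u $ i"
    and l: "l \<in> complex_eigenvalues A"
  shows "cmod l \<le> r"
proof -
  obtain w where w0: "w \<noteq> 0" and w: "map_matrix complex_of_real A *v w = l *s w"
    using l by (auto simp: complex_eigenvalues_def)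
  define c where "c = Max (range (\<lambda>i. cmod (w $ i) / u $ i))"
  have "c \<in> range (\<lambda>i. cmod (w $ i) / u $ i)"
    unfolding c_def by (rule Max_in) auto
  then obtain i where i: "c = cmod (w $ i) / u $ i" by auto
  have le: "cmod (w $ j) \<le> c * u $ j" for j
  proof -
    have "cmod (w $ j) / u $ j \<le> c" unfolding c_def by (rule Max_ge) auto
    then show ?thesis using u[of j] by (simp add: divide_le_eq)
  qed
  have "c > 0"
  proof -
    obtain j where "w $ j \<noteq> 0" using w0 by (auto simp: vec_eq_iff)
    then have "0 < c * u $ j" using le[of j] by (smt (verit) zero_less_norm_iff)
    then show ?thesis using u[of j] by (simp add: zero_less_mult_iff)
  qed
  have "cmod l * (c * u $ i) = cmod ((map_matrix complex_of_real A *v w) $ i)"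
    using u[of i] by (simp add: w i norm_mult)
  also have "\<dots> = cmod (\<Sum>j\<in>UNIV. complex_of_real (A $ i $ j) * w $ j)"
    by (simp add: matrix_vector_mult_def map_matrix_def)
  also have "\<dots> \<le> (\<Sum>j\<in>UNIV. \<bar>A $ i $ j\<bar> * (c * u $ j))"
    by (rule sum_norm_le) (simp add: norm_mult le mult_left_mono)
  also have "\<dots> = c * (\<Sum>j\<in>UNIV. \<bar>A $ i $ j\<bar> * u $ j)"
    by (simp add: sum_distrib_left mult_ac)
  also have "\<dots> \<le> c * (r * u $ i)"
    using Au[of i] \<open>c > 0\<close> by (intro mult_left_mono) auto
  finally have "cmod l * (c * u $ i) \<le> r * (c * u $ i)" by (simp add: mult_ac)
  then show ?thesis using \<open>c > 0\<close> u[of i] by simp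
qed

text \<open>
  The maximum in the definition of the spectral radius is meaningful only for a finite set. The
  eigenvalues are the zeros of the characteristic polynomial, which is here the determinant of
  a matrix of polynomials. It is not the zero polynomial because eigenvalues are bounded.
\<close>

lemma finite_complex_eigenvalues:
  fixes A :: "real^'n^'n"
  shows "finite (complex_eigenvalues A)"
proof -
  define r where "r = (\<Sum>i\<in>UNIV. \<Sum>j\<in>UNIV. \<bar>A $ i $ j\<bar>)"
  define M :: "complex \<Rightarrow> complex^'n^'n"
    where "M l = (\<chi> i j. complex_of_real (A $ i $ j) - (if i = j then l else 0))" for l
  define P :: "complex poly^'n^'n"
    where "P = (\<chi> i j. [:complex_of_real (A $ i $ j), if i = j then -1 else 0:])"
  have poly_det: "poly (det P) l = det (M l)" for l
  proof -
    have entry: "poly (P $ i $ j) l = M l $ i $ j" for i j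
      by (simp add: P_def M_def)
    show ?thesis
      by (simp add: det_def poly_sum poly_prod entry)
  qed
  have Mv: "M l *v w = map_matrix complex_of_real A *v w - l *s w" for l w
  proof (rule vec_eq_iff[THEN iffD2, rule_format])
    fix i
    have "(M l *v w) $ i = (\<Sum>j\<in>UNIV. complex_of_real (A $ i $ j) * w $ j - (if i = j then l * w $ j else 0))"
      by (auto simp: matrix_vector_mult_def M_def left_diff_distrib intro!: sum.cong)
    then show "(M l *v w) $ i = (map_matrix complex_of_real A *v w - l *s w) $ i"
      by (simp add: sum_subtractf matrix_vector_mult_def)
  qed
  have ev_iff: "l \<in> complex_eigenvalues A \<longleftrightarrow> poly (det P) l = 0" for l
  proof -
    have "l \<in> complex_eigenvalues A \<longleftrightarrow> \<not> (\<forall>w. M l *v w = 0 \<longrightarrow> w = 0)"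
      by (auto simp: complex_eigenvalues_def Mv)
    also have "\<dots> \<longleftrightarrow> det (M l) = 0"
      by (metis invertible_det_nz invertible_left_inverse matrix_left_invertible_ker)
    finally show ?thesis by (simp add: poly_det)
  qed
  have "cmod l \<le> r" if "l \<in> complex_eigenvalues A" for l
  proof (rule complex_eigenvalue_le_weighted_row_sums[where u = "\<chi> i. 1", OF _ _ that])
    show "(\<Sum>j\<in>UNIV. \<bar>A $ i $ j\<bar> * (\<chi> i. 1) $ j) \<le> r * (\<chi> i. 1) $ i" for i
      unfolding r_def using member_le_sum[of i UNIV "\<lambda>i. \<Sum>j\<in>UNIV. \<bar>A $ i $ j\<bar>"]
      by (simp add: sum_nonneg)
  qed simp
  moreover have "r \<ge> 0" unfolding r_def by (simp add: sum_nonneg)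
  ultimately have "complex_of_real (r + 1) \<notin> complex_eigenvalues A"
    by (smt (verit) norm_of_real)
  then have "det P \<noteq> 0" using ev_iff by force
  then show ?thesis
    using poly_roots_finite[of "det P"] by (simp add: ev_iff[symmetric])
qed

text \<open>
  The eigenvector itself, taken as weight, bounds all other eigenvalues by \<open>r\<close>. So a real
  computation settles a maximum over complex numbers.
\<close>

lemma spectral_radius_eq_if_positive_eigenvector:
  fixes B :: "real^'n^'n"
  assumes B: "\<And>i j. 0 \<le> B $ i $ j" and u: "\<And>i. 0 < u $ i" and Bu: "B *v u = r *\<^sub>R u"
  shows "spectral_radius B = r"
proof -
  have bound: "cmod l \<le> r" if "l \<in> complex_eigenvalues B" for l
  proof (rule complex_eigenvalue_le_weighted_row_sums[OF u _ that])
    show "(\<Sum>j\<in>UNIV. \<bar>B $ i $ j\<bar> * u $ j) \<le> r * u $ i" for i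
      using Bu B by (simp add: vec_eq_iff matrix_vector_mult_def)
  qed
  define w :: "complex^'n" where "w = (\<chi> i. complex_of_real (u $ i))"
  fix i0 :: 'n
  have "w $ i0 \<noteq> 0" using u[of i0] by (simp add: w_def)
  then have w0: "w \<noteq> 0" by auto
  have "(map_matrix complex_of_real B *v w) $ i = (complex_of_real r *s w) $ i" for i
  proof -
    have "(map_matrix complex_of_real B *v w) $ i = complex_of_real ((B *v u) $ i)"
      by (simp add: matrix_vector_mult_def map_matrix_def w_def)
    then show ?thesis by (simp add: Bu w_def)
  qed
  with w0 have ev: "complex_of_real r \<in> complex_eigenvalues B"
    unfolding complex_eigenvalues_def by (auto simp: vec_eq_iff)
  have "r \<ge> 0" using bound[OF ev] norm_ge_zero order_trans by blast
  then have "r \<in> cmod ` complex_eigenvalues B" using ev by (force simp: image_iff)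
  then show ?thesis unfolding spectral_radius_def
    using bound finite_complex_eigenvalues
    by (intro Max_eqI) auto
qed

section \<open>Perron's theorem for positive matrices\<close>

lemma positive_matrix_times_nonneg:
  fixes B :: "real^'n^'n"
  assumes B: "\<And>i j. 0 < B $ i $ j" and v: "\<And>i. 0 \<le> v $ i" "v \<noteq> 0"
  shows "0 < (B *v v) $ i"
proof -
  obtain j where "v $ j \<noteq> 0" using v(2) by (auto simp: vec_eq_iff)
  then have "0 < B $ i $ j * v $ j" using B[of i j] v(1)[of j] by simp
  then show ?thesis unfolding matrix_vector_mult_def
    using B v(1) by (auto intro!: sum_pos2[of _ j] simp: less_imp_le)
qed

text \<open>
  The map \<open>x \<mapsto> B x\<close>, rescaled to coordinate sum one, sends the standard simplex to itself.
  Its Brouwer fixed point is an eigenvector, which is positive because \<open>B\<close> is.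
\<close>

lemma perron_vector_exists:
  fixes B :: "real^'n^'n"
  assumes B: "\<And>i j. 0 < B $ i $ j"
  obtains u where "\<And>i. 0 < u $ i" "B *v u = spectral_radius B *\<^sub>R u"
proof -
  define S :: "(real^'n) set" where "S = {x. (\<forall>i. 0 \<le> x $ i) \<and> (\<Sum>i\<in>UNIV. x $ i) = 1}"
  define t :: "real^'n \<Rightarrow> real" where "t = (\<lambda>x. \<Sum>i\<in>UNIV. (B *v x) $ i)"
  have S0: "x \<noteq> 0" if "x \<in> S" for x using that by (auto simp: S_def)
  have Bpos: "0 < (B *v x) $ i" if "x \<in> S" for x i
    using positive_matrix_times_nonneg[OF B] that S0[OF that] by (auto simp: S_def)
  have tpos: "0 < t x" if "x \<in> S" for x
    unfolding t_def using Bpos[OF that] by (intro sum_pos) auto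
  have "compact S"
  proof -
    have "closed S"
      unfolding S_def by (intro closed_Collect_conj closed_Collect_all closed_Collect_le closed_Collect_eq continuous_intros)
    moreover have "bounded S"
    proof (rule boundedI)
      fix x assume "x \<in> S"
      then show "norm x \<le> 1" using norm_le_l1_cart[of x] by (simp add: S_def)
    qed
    ultimately show ?thesis by (simp add: compact_eq_bounded_closed)
  qed
  moreover have "convex S"
    by (auto simp: convex_def S_def sum.distrib simp flip: sum_distrib_left)
  moreover have "S \<noteq> {}"
  proof -
    have "(\<chi> i. 1 / real CARD('n)) \<in> S" by (simp add: S_def)
    then show ?thesis by blast
  qed
  moreover have "continuous_on S (\<lambda>x. (1 / t x) *\<^sub>R (B *v x))"
  proof -
    have "continuous_on S ((*v) B)" by (intro linear_continuous_on matrix_vector_mul_bounded_linear)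
    moreover have "continuous_on S t" unfolding t_def
      by (intro continuous_intros calculation)
    moreover have "\<forall>x\<in>S. t x \<noteq> 0" using tpos by force
    ultimately show ?thesis by (intro continuous_intros) auto
  qed
  moreover have "(\<lambda>x. (1 / t x) *\<^sub>R (B *v x)) \<in> S \<rightarrow> S"
  proof
    fix x assume x: "x \<in> S"
    have "(\<Sum>i\<in>UNIV. (B *v x) $ i / t x) = 1"
      unfolding sum_divide_distrib[symmetric] using tpos[OF x] by (simp add: t_def)
    then show "(1 / t x) *\<^sub>R (B *v x) \<in> S"
      using tpos[OF x] Bpos[OF x] by (simp add: S_def less_imp_le)
  qed
  ultimately obtain u where u: "u \<in> S" "(1 / t u) *\<^sub>R (B *v u) = u"
    using brouwer by blast
  have Bu: "B *v u = t u *\<^sub>R u"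
    using tpos[OF u(1)] by (subst (2) u(2)[symmetric]) simp
  have pos: "0 < u $ i" for i
    using Bpos[OF u(1), of i] tpos[OF u(1)] by (simp add: Bu zero_less_mult_iff)
  have "spectral_radius B = t u"
    by (rule spectral_radius_eq_if_positive_eigenvector[OF _ pos Bu]) (simp add: B less_imp_le)
  then show ?thesis using that[OF pos] Bu by simp
qed

text \<open>
  A left eigenvector is a right eigenvector of the transpose. Pairing it with the right Perron
  vector shows that both belong to the same eigenvalue.
\<close>

lemma left_perron_vector_exists:
  fixes B :: "real^'n^'n"
  assumes B: "\<And>i j. 0 < B $ i $ j"
  obtains y where "\<And>i. 0 < y $ i" "\<And>x. y \<bullet> (B *v x) = spectral_radius B * (y \<bullet> x)"
proof -
  obtain u where u: "\<And>i. 0 < u $ i" "B *v u = spectral_radius B *\<^sub>R u"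
    using perron_vector_exists[OF B] by blast
  have "0 < transpose B $ i $ j" for i j by (simp add: transpose_def B)
  then obtain y s where y: "\<And>i. 0 < y $ i" "transpose B *v y = s *\<^sub>R y"
    using perron_vector_exists by blast
  have left: "y \<bullet> (B *v x) = s * (y \<bullet> x)" for x
    using y(2) by (metis dot_lmul_matrix inner_scaleR_left transpose_matrix_vector)
  have "0 < y \<bullet> u" unfolding inner_vec_def using u(1) y(1) by (intro sum_pos) auto
  moreover have "s * (y \<bullet> u) = spectral_radius B * (y \<bullet> u)"
    using left[of u] by (auto simp: u(2))
  ultimately have "s = spectral_radius B"
    by (metis less_irrefl mult_cancel_right)
  then show ?thesis using that y(1) left by blast
qed

text \<open>
  Subtract from \<open>u\<close> the largest multiple of \<open>v\<close> that leaves a non-negative vector. The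
  difference satisfies the same eigenvector equation and has a zero component, whereas \<open>B\<close> maps
  non-zero non-negative vectors to positive ones; so it vanishes.
\<close>

lemma positive_matrix_leading_eigenvector_unique:
  fixes B :: "real^'n^'n"
  assumes B: "\<And>i j. 0 < B $ i $ j"
    and u: "leading_eigenvector B u" "norm u = 1"
    and v: "leading_eigenvector B v" "norm v = 1"
  shows "u = v"
proof -
  let ?r = "spectral_radius B"
  have nz: "0 < x $ i" if x: "\<And>i. 0 \<le> x $ i" "x \<noteq> 0" "B *v x = ?r *\<^sub>R x" for x i
    using positive_matrix_times_nonneg[OF B x(1,2), of i] x(1)[of i]
    by (simp add: x(3) zero_less_mult_iff)
  have vpos: "0 < v $ i" for i using nz v by (auto simp: leading_eigenvector_def)
  define c where "c = Min (range (\<lambda>i. u $ i / v $ i))"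
  have "c \<in> range (\<lambda>i. u $ i / v $ i)"
    unfolding c_def by (rule Min_in) auto
  then obtain i where i: "c = u $ i / v $ i" by auto
  have le: "0 \<le> (u - c *\<^sub>R v) $ j" for j
  proof -
    have "c \<le> u $ j / v $ j" unfolding c_def by (rule Min_le) auto
    then show ?thesis using vpos[of j] by (simp add: le_divide_eq)
  qed
  have "B *v (u - c *\<^sub>R v) = ?r *\<^sub>R (u - c *\<^sub>R v)"
    using u v by (simp add: leading_eigenvector_def matrix_vector_mult_diff_distrib
      matrix_vector_mult_scaleR scaleR_diff_right)
  moreover have "(u - c *\<^sub>R v) $ i = 0" using vpos[of i] i by simp
  ultimately have "u - c *\<^sub>R v = 0" using nz[OF le, of i] by (metis less_irrefl)
  then have uc: "u = c *\<^sub>R v" by simp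
  moreover have "c \<ge> 0" using u(1) vpos[of i] i by (simp add: leading_eigenvector_def)
  ultimately show ?thesis using u(2) v(2) by simp
qed

text \<open>
  A normalized Perron vector of \<open>A + e E\<close> is the only candidate, so the definite description
  denotes it.
\<close>

lemma perturbed_leading_eigenvector_leading:
  fixes A :: "real^'n^'n"
  assumes A: "\<And>i j. 0 \<le> A $ i $ j" and e: "0 < e"
  shows "leading_eigenvector (A + e *\<^sub>R ones_matrix) (perturbed_leading_eigenvector A e)"
proof -
  let ?B = "A + e *\<^sub>R ones_matrix"
  have B: "0 < ?B $ i $ j" for i j using A[of i j] e by (simp add: ones_matrix_def)
  obtain u where u: "\<And>i. 0 < u $ i" "?B *v u = spectral_radius ?B *\<^sub>R u"
    using perron_vector_exists[OF B] by blast
  fix i0 :: 'n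
  have u0: "u \<noteq> 0" using u(1)[of i0] by auto
  then have "leading_eigenvector ?B ((1 / norm u) *\<^sub>R u) \<and> norm ((1 / norm u) *\<^sub>R u) = 1"
    using u by (simp add: leading_eigenvector_def less_imp_le matrix_vector_mult_scaleR)
  then have "\<exists>!v. leading_eigenvector ?B v \<and> norm v = 1"
    using positive_matrix_leading_eigenvector_unique[OF B] by blast
  from theI'[OF this] show ?thesis by (simp add: perturbed_leading_eigenvector_def)
qed

section \<open>Monotonicity of the perturbed spectral radius\<close>

text \<open>
  With a positive left Perron vector \<open>y\<close> of \<open>C\<close>,
  \<open>y \<bullet> (C v - B v) = (\<rho>(C) - \<rho>(B)) (y \<bullet> v)\<close> and \<open>y \<bullet> v > 0\<close>. The left-hand side has the
  sign of the components of \<open>C v - B v\<close>. The sign \<open>s\<close> covers both directions.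
\<close>

lemma spectral_radius_compare_on_leading_eigenvector:
  fixes B C :: "real^'n^'n"
  assumes C: "\<And>i j. 0 < C $ i $ j" and v: "leading_eigenvector B v"
    and ge: "\<And>i. 0 \<le> s * ((C *v v) $ i - (B *v v) $ i)"
  shows "s * spectral_radius B \<le> s * spectral_radius C"
    and "0 < s * ((C *v v) $ i - (B *v v) $ i) \<Longrightarrow> s * spectral_radius B < s * spectral_radius C"
proof -
  obtain y where y: "\<And>i. 0 < y $ i" "\<And>x. y \<bullet> (C *v x) = spectral_radius C * (y \<bullet> x)"
    using left_perron_vector_exists[OF C] by blast
  let ?g = "\<lambda>i. y $ i * (s * ((C *v v) $ i - (B *v v) $ i))"
  obtain j where "v $ j \<noteq> 0" using v by (auto simp: leading_eigenvector_def vec_eq_iff)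
  then have yv: "0 < y \<bullet> v" unfolding inner_vec_def
    using v y(1) by (intro sum_pos2[of _ j]) (auto simp: leading_eigenvector_def less_le)
  have "(\<Sum>i\<in>UNIV. ?g i) = s * (y \<bullet> (C *v v) - y \<bullet> (B *v v))"
    by (simp add: inner_vec_def sum_distrib_left sum_subtractf algebra_simps)
  also have "\<dots> = (s * spectral_radius C - s * spectral_radius B) * (y \<bullet> v)"
    using v by (simp add: y(2) leading_eigenvector_def algebra_simps)
  finally have eq: "(\<Sum>i\<in>UNIV. ?g i) = (s * spectral_radius C - s * spectral_radius B) * (y \<bullet> v)" .
  have g: "0 \<le> ?g i" for i using y(1)[of i] ge[of i] by simp
  then have "0 \<le> (\<Sum>i\<in>UNIV. ?g i)" by (simp add: sum_nonneg)
  then show "s * spectral_radius B \<le> s * spectral_radius C"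
    using yv by (simp add: eq zero_le_mult_iff)
  assume "0 < s * ((C *v v) $ i - (B *v v) $ i)"
  then have "0 < ?g i" using y(1)[of i] by simp
  then have "0 < (\<Sum>i\<in>UNIV. ?g i)" using g by (intro sum_pos2[of _ i]) auto
  then show "s * spectral_radius B < s * spectral_radius C"
    using yv by (simp add: eq zero_less_mult_iff)
qed

text \<open>
  The strict row inequalities at the selected eigenvector carry over to the perturbed eigenvectors
  that converge to it, and there the matrices are positive, so that the comparison applies. At
  \<open>e = 0\<close> strictness would fail in general: when \<open>A'\<close> is reducible, its left leading
  eigenvectors may vanish on the rows that changed.
\<close>

lemma eventually_perturbed_spectral_radius_mono:
  fixes A A' :: "real^'n^'n"
  assumes A: "\<And>i j. 0 \<le> A $ i $ j" and A': "\<And>i j. 0 \<le> A' $ i $ j"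
    and v: "selected_leading_eigenvector A v"
    and step: "\<And>i. row i A' = row i A \<or> s * (row i A \<bullet> v) < s * (row i A' \<bullet> v)"
  shows "eventually (\<lambda>e. s * spectral_radius (A + e *\<^sub>R ones_matrix) \<le> s * spectral_radius (A' + e *\<^sub>R ones_matrix)
      \<and> (A' \<noteq> A \<longrightarrow> s * spectral_radius (A + e *\<^sub>R ones_matrix) < s * spectral_radius (A' + e *\<^sub>R ones_matrix)))
     (at_right 0)"
proof -
  let ?w = "perturbed_leading_eigenvector A"
  have lim: "(?w \<longlongrightarrow> v) (at_right 0)" using v by (simp add: selected_leading_eigenvector_def)
  have "eventually (\<lambda>e. row i A' = row i A \<or> s * (row i A \<bullet> ?w e) < s * (row i A' \<bullet> ?w e)) (at_right 0)" for i
  proof (cases "row i A' = row i A")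
    case False
    have "((\<lambda>e. s * (row i A' \<bullet> ?w e) - s * (row i A \<bullet> ?w e)) \<longlongrightarrow> s * (row i A' \<bullet> v) - s * (row i A \<bullet> v)) (at_right 0)"
      by (intro tendsto_intros lim)
    moreover have "0 < s * (row i A' \<bullet> v) - s * (row i A \<bullet> v)" using step[of i] False by simp
    ultimately have "eventually (\<lambda>e. 0 < s * (row i A' \<bullet> ?w e) - s * (row i A \<bullet> ?w e)) (at_right 0)"
      by (rule order_tendstoD)
    then show ?thesis by eventually_elim simp
  qed simp
  then have "eventually (\<lambda>e. \<forall>i. row i A' = row i A \<or> s * (row i A \<bullet> ?w e) < s * (row i A' \<bullet> ?w e)) (at_right 0)"
    by (simp add: eventually_all_finite)
  moreover have "eventually (\<lambda>e. (0::real) < e) (at_right 0)" by (rule eventually_at_right_less)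
  ultimately show ?thesis
  proof eventually_elim
    case (elim e)
    let ?B = "A + e *\<^sub>R ones_matrix" and ?C = "A' + e *\<^sub>R ones_matrix"
    have C: "0 < ?C $ i $ j" for i j using A'[of i j] elim by (simp add: ones_matrix_def)
    have lead: "leading_eigenvector ?B (?w e)" using perturbed_leading_eigenvector_leading[OF A] elim by blast
    have diff: "s * ((?C *v ?w e) $ i - (?B *v ?w e) $ i) = s * (row i A' \<bullet> ?w e) - s * (row i A \<bullet> ?w e)" for i
      by (simp add: matrix_vector_mul_component row_def inner_add_left algebra_simps)
    have ge: "0 \<le> s * ((?C *v ?w e) $ i - (?B *v ?w e) $ i)" for i
      unfolding diff using elim(1) by (metis diff_ge_0_iff_ge order_refl less_imp_le)
    have "s * spectral_radius ?B < s * spectral_radius ?C" if ne: "A' \<noteq> A"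
    proof -
      obtain i where "row i A' \<noteq> row i A" using ne by (auto simp: row_def vec_eq_iff)
      then have "0 < s * ((?C *v ?w e) $ i - (?B *v ?w e) $ i)" unfolding diff using elim(1) by force
      then show ?thesis by (rule spectral_radius_compare_on_leading_eigenvector(2)[OF C lead ge])
    qed
    then show ?case using spectral_radius_compare_on_leading_eigenvector(1)[OF C lead ge] by blast
  qed
qed

section \<open>The greedy method\<close>

lemma greedy_run_in_product_family:
  assumes run: "greedy_run opt F A v" and opt: "\<And>f P a. opt f P a \<Longrightarrow> P a" and "j \<ge> 1"
  shows "A j \<in> product_family F"
  using \<open>j \<ge> 1\<close>
proof (induction j rule: dec_induct)
  case base
  then show ?case using run by (simp add: greedy_run_def)
next
  case (step j)
  then have "greedy_step opt F (v j) (A j) (A (Suc j))" using run by (simp add: greedy_run_def)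
  then show ?case using step.IH opt unfolding greedy_step_def product_family_def
    by (smt (verit) mem_Collect_eq)
qed

text \<open>
  Maximality and minimality enter through two properties, stated here for \<open>opt\<close> with
  \<open>s = 1\<close> and \<open>s = -1\<close> respectively: an optimal point is feasible, and it strictly
  improves on any feasible point that is not optimal. The second one makes every replaced row
  strictly better, which is where the rule of keeping rows that are already optimal matters.
\<close>

lemma selective_greedy_run_no_cycle:
  fixes F :: "'n::finite \<Rightarrow> (real^'n) set"
  assumes nonneg: "\<And>i a j. a \<in> F i \<Longrightarrow> 0 \<le> a $ j"
    and run: "selective_greedy_run opt F A v"
    and opt_mem: "\<And>f P a. opt f P a \<Longrightarrow> P a"
    and opt_less: "\<And>(f :: real^'n \<Rightarrow> real) P a b. P a \<Longrightarrow> \<not> opt f P a \<Longrightarrow> opt f P b \<Longrightarrow> s * f a < s * f b"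
    and k: "k \<ge> 1" and n: "n \<ge> 1" and cycle: "A (k + n) = A k"
  shows "A (k + 1) = A k"
proof (rule ccontr)
  assume ne: "A (k + 1) \<noteq> A k"
  have grun: "greedy_run opt F A v" using run by (simp add: selective_greedy_run_def)
  have mem: "row i (A j) \<in> F i" if "j \<ge> 1" for i j
    using greedy_run_in_product_family[OF grun _ that] opt_mem by (auto simp: product_family_def)
  have A: "0 \<le> A j $ i $ l" if "j \<ge> 1" for i j l
    using nonneg[OF mem[OF that, of i], of l] by (simp add: row_def)
  let ?R = "\<lambda>j e. s * spectral_radius (A j + e *\<^sub>R ones_matrix)"
  have "eventually (\<lambda>e. ?R j e \<le> ?R (Suc j) e \<and> (A (Suc j) \<noteq> A j \<longrightarrow> ?R j e < ?R (Suc j) e)) (at_right 0)"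
    if j: "j \<ge> 1" for j
  proof (rule eventually_perturbed_spectral_radius_mono)
    show "selected_leading_eigenvector (A j) (v j)" using run j by (simp add: selective_greedy_run_def)
    have "greedy_step opt F (v j) (A j) (A (Suc j))" using grun j by (simp add: greedy_run_def)
    then show "row i (A (Suc j)) = row i (A j) \<or> s * (row i (A j) \<bullet> v j) < s * (row i (A (Suc j)) \<bullet> v j)" for i
      using opt_less[of "\<lambda>a. a \<in> F i" "row i (A j)" "\<lambda>a. a \<bullet> v j"] mem[OF j, of i]
      unfolding greedy_step_def by metis
  qed (use A j in auto)
  \<comment> \<open>Only finitely many steps lie on the cycle, so one perturbation serves all of them.\<close>
  then have "eventually (\<lambda>e. \<forall>j\<in>{k..<k+n}. ?R j e \<le> ?R (Suc j) e \<and> (A (Suc j) \<noteq> A j \<longrightarrow> ?R j e < ?R (Suc j) e)) (at_right 0)"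
    using k by (intro eventually_ball_finite) auto
  then obtain e where e: "\<forall>j\<in>{k..<k+n}. ?R j e \<le> ?R (Suc j) e \<and> (A (Suc j) \<noteq> A j \<longrightarrow> ?R j e < ?R (Suc j) e)"
    using eventually_happens'[OF trivial_limit_at_right_real] by blast
  have "?R (k + 1) e \<le> ?R j e" if "k + 1 \<le> j" "j \<le> k + n" for j
    using that
  proof (induction j rule: dec_induct)
    case (step j)
    then show ?case using e by (meson Suc_leD atLeastLessThan_iff add_leD1 less_eq_Suc_le order_trans)
  qed simp
  from this[of "k + n"] have "?R (k + 1) e \<le> ?R k e" using n cycle by simp
  moreover have "?R k e < ?R (k + 1) e" using e ne n by simp
  ultimately show False by simp
qed

theorem theorem2:
  fixes F :: "'n::finite \<Rightarrow> (real^'n) set"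
    and A :: "nat \<Rightarrow> real^'n^'n"
    and v :: "nat \<Rightarrow> real^'n"
    and k n :: nat
  assumes "\<And>i. F i \<noteq> {}"
    and "\<And>i. compact (F i)"
    and "\<And>i a j. a \<in> F i \<Longrightarrow> 0 \<le> a $ j"
    and "selective_greedy_run is_arg_max F A v \<or> selective_greedy_run is_arg_min F A v"
    and "k \<ge> 1" and "n \<ge> 1"
    and "A (k + n) = A k"
  shows "A (k + 1) = A k"
  using assms(4)
proof
  assume run: "selective_greedy_run is_arg_max F A v"
  show ?thesis
    by (rule selective_greedy_run_no_cycle[OF assms(3) run _ _ assms(5-7), where s = 1])
      (auto simp: is_arg_max_def not_less intro: less_le_trans)
next
  assume run: "selective_greedy_run is_arg_min F A v"
  show ?thesis
    by (rule selective_greedy_run_no_cycle[OF assms(3) run _ _ assms(5-7), where s = "-1"])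
      (auto simp: is_arg_min_def not_less intro: le_less_trans)
qed

end
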